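(* Suppose that $|rx|<1$. Then $$\sum_{n=0}^\infty p_n(x,y,a)\frac{(s/r;q)_n\,r^n}{(q;q)_n}=\frac{(sx;q)_\infty}{(rx;q)_\infty}\;{}_2\Phi_2\left[\begin{array}{c}a,\,s/r\\ sx,\,0\end{array};q;\,ry\right].$$
   Context: $q$ is a fixed complex number with $|q|<1$; $a,x,y,r,s$ are complex numbers for which the expressions are defined ($r\ne0$, and $sx$ is such that $(sx;q)_n\neq 0$ for all $n$). The $q$-shifted factorials are $(a;q)_0=1$, $(a;q)_n=\prod_{i=0}^{n-1}(1-aq^i)$, $(a;q)_\infty=\prod_{i=0}^\infty(1-aq^i)$, and $(a_1,\dots,a_m;q)_n=\prod_{j}(a_j;q)_n$. The basic hypergeometric series is $${}_{r}\Phi_{s}\left[\begin{array}{c}a_1,\ldots,a_r\\ b_1,\ldots,b_s\end{array};q;z\right]=\sum_{n=0}^\infty\Big[(-1)^nq^{n(n-1)/2}\Big]^{1+s-r}\frac{(a_1,\ldots,a_r;q)_n}{(b_1,\ldots,b_s;q)_n}\frac{z^n}{(q;q)_n}$$ (here $r,s$ are the numbers of numerator and denominator parameters, unrelated to the complex numbers $r,s$ of the claim). With $\binom{n}{k}_q=\frac{(q;q)_n}{(q;q)_k(q;q)_{n-k}}$, the generalized Cauchy polynomials are $$p_n(x,y,a)=\sum_{k=0}^n\binom{n}{k}_q(-1)^kq^{k(k-1)/2}(a;q)_k\,x^{n-k}y^k.$$ *)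

theory Defs
  imports "HOL-Analysis.Analysis"
begin

definition qpoch :: "complex \<Rightarrow> complex \<Rightarrow> nat \<Rightarrow> complex" where
  "qpoch a q n = (\<Prod>i<n. 1 - a * q ^ i)"

definition qpoch_inf :: "complex \<Rightarrow> complex \<Rightarrow> complex" where
  "qpoch_inf a q = (\<Prod>i. 1 - a * q ^ i)"

lemma has_prod_qpoch_inf:
  assumes "norm q < 1"
  shows "(\<lambda>i. 1 - a * q ^ i) has_prod qpoch_inf a q"
proof -
  have "summable (\<lambda>i. norm ((1 - a * q ^ i) - 1))"
    using assms by (simp add: norm_mult norm_power summable_mult)
  then have "abs_convergent_prod (\<lambda>i. 1 - a * q ^ i)"
    by (rule summable_imp_abs_convergent_prod)
  then show ?thesis
    unfolding qpoch_inf_def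
    by (intro convergent_prod_has_prod abs_convergent_prod_imp_convergent_prod)
qed

definition qpoch_list :: "complex list \<Rightarrow> complex \<Rightarrow> nat \<Rightarrow> complex" where
  "qpoch_list as q n = (\<Prod>a\<leftarrow>as. qpoch a q n)"

definition qbinom :: "complex \<Rightarrow> nat \<Rightarrow> nat \<Rightarrow> complex" where
  "qbinom q n k = qpoch q q n / (qpoch q q k * qpoch q q (n - k))"

text \<open>The exponent (one plus the number of denominator parameters minus the number of numerator
  parameters) may be negative, hence the integer power.\<close>
definition Phi_term ::
    "complex list \<Rightarrow> complex list \<Rightarrow> complex \<Rightarrow> complex \<Rightarrow> nat \<Rightarrow> complex" where
  "Phi_term as bs q z n =
     ((-1) ^ n * q ^ (n * (n - 1) div 2)) powi (1 + int (length bs) - int (length as))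
     * (qpoch_list as q n / qpoch_list bs q n) * (z ^ n / qpoch q q n)"

definition Phi :: "complex list \<Rightarrow> complex list \<Rightarrow> complex \<Rightarrow> complex \<Rightarrow> complex" where
  "Phi as bs q z = (\<Sum>n. Phi_term as bs q z n)"

definition gen_cauchy_poly ::
    "complex \<Rightarrow> nat \<Rightarrow> complex \<Rightarrow> complex \<Rightarrow> complex \<Rightarrow> complex" where
  "gen_cauchy_poly q n x y a =
     (\<Sum>k\<le>n. qbinom q n k * (-1) ^ k * q ^ (k * (k - 1) div 2) * qpoch a q k
            * x ^ (n - k) * y ^ k)"

end

theory Submission
  imports Defs
begin

text \<open>
  Write \<open>b = s / r\<close>.  Expanding \<open>p\<^sub>n\<close> and cancelling \<open>(q;q)\<^sub>n\<close> turns the left-hand side into a sum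
  over pairs \<open>k \<le> n\<close>; with \<open>n = k + m\<close> its general term is
  \[ (-1)^k q^{k(k-1)/2} \frac{(a;q)_k (ry)^k}{(q;q)_k} \cdot (b;q)_{k+m} \frac{(rx)^m}{(q;q)_m}. \]
  All the symbols \<open>(c;q)\<^sub>n\<close> and \<open>1/(q;q)\<^sub>n\<close> are bounded in \<open>n\<close>, so the term is dominated by a
  constant times \<open>|q|^{k(k-1)/2} |ry|^k |rx|^m\<close>, which is summable over all pairs because
  \<open>|rx| < 1\<close>.  Hence the order of summation may be exchanged
  (\<open>sums_antidiagonal_eq_iterated\<close>).

  For fixed \<open>k\<close>, split \<open>(b;q)\<^sub>k\<^sub>+\<^sub>m = (b;q)\<^sub>k (b q^k;q)\<^sub>m\<close>.  The sum over \<open>m\<close> is then an instance of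
  the \<open>q\<close>-binomial theorem (\<open>q_binomial_theorem\<close>), with value
  \<open>(sx q^k;q)\<^sub>\<infinity> / (rx;q)\<^sub>\<infinity> = (sx;q)\<^sub>\<infinity> / ((sx;q)\<^sub>k (rx;q)\<^sub>\<infinity>)\<close>.  The factor \<open>(sx;q)\<^sub>k\<close> becomes the
  denominator parameter of the series \<open>\<^sub>2\<Phi>\<^sub>2\<close>, and the remaining quotient of infinite products is
  independent of \<open>k\<close>.
\<close>

section \<open>Shifted factorials\<close>

lemma qpoch_0 [simp]: "qpoch a q 0 = 1"
  by (simp add: qpoch_def)

lemma qpoch_Suc: "qpoch a q (Suc n) = qpoch a q n * (1 - a * q ^ n)"
  by (simp add: qpoch_def)

lemma qpoch_zero_left [simp]: "qpoch 0 q n = 1"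
  by (simp add: qpoch_def)

lemma qpoch_add: "qpoch a q (k + m) = qpoch a q k * qpoch (a * q ^ k) q m"
  by (induction m) (simp_all add: qpoch_Suc power_add mult_ac)

lemma qpoch_tendsto_qpoch_inf:
  assumes "norm q < 1"
  shows "qpoch a q \<longlonglongrightarrow> qpoch_inf a q"
  using has_prod_imp_tendsto'[OF has_prod_qpoch_inf[OF assms, of a]]
  by (simp add: qpoch_def [abs_def])

lemma qpoch_inf_shift:
  assumes "norm q < 1"
  shows "qpoch_inf a q = qpoch a q k * qpoch_inf (a * q ^ k) q"
proof (rule LIMSEQ_unique)
  show "(\<lambda>m. qpoch a q (k + m)) \<longlonglongrightarrow> qpoch_inf a q"
    using LIMSEQ_ignore_initial_segment[OF qpoch_tendsto_qpoch_inf[OF assms, of a], of k]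
    by (simp add: add.commute)
  show "(\<lambda>m. qpoch a q (k + m)) \<longlonglongrightarrow> qpoch a q k * qpoch_inf (a * q ^ k) q"
    unfolding qpoch_add by (intro tendsto_mult_left qpoch_tendsto_qpoch_inf assms)
qed

lemma qpoch_inf_nonzero:
  assumes "norm q < 1" "\<And>n. qpoch a q n \<noteq> 0"
  shows "qpoch_inf a q \<noteq> 0"
proof -
  have "1 - a * q ^ i \<noteq> 0" for i
    using assms(2)[of "Suc i"] by (simp add: qpoch_Suc)
  then show ?thesis
    using has_prod_eq_0_iff[OF has_prod_qpoch_inf[OF assms(1), of a]] by auto
qed

lemma qpoch_nonzero:
  assumes "norm q < 1" "norm a < 1"
  shows "qpoch a q n \<noteq> 0"
proof -
  have "a * q ^ i \<noteq> 1" for i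
  proof
    assume "a * q ^ i = 1"
    moreover have "norm a * norm q ^ i \<le> norm a * 1"
      using assms by (intro mult_left_mono power_le_one) auto
    ultimately show False
      using assms(2) by (metis mult.right_neutral norm_mult norm_one norm_power not_less)
  qed
  then show ?thesis
    by (simp add: qpoch_def)
qed

lemma Bseq_qpoch:
  assumes "norm q < 1"
  shows "Bseq (qpoch a q)"
  using qpoch_tendsto_qpoch_inf[OF assms] by (intro convergent_imp_Bseq convergentI)

text \<open>The reciprocals converge as well, since the infinite product \<open>(q;q)\<^sub>\<infinity>\<close> does not vanish.\<close>
lemma Bseq_inverse_qpoch:
  assumes "norm q < 1"
  shows "Bseq (\<lambda>n. 1 / qpoch q q n)"
proof -
  have "(\<lambda>n. 1 / qpoch q q n) \<longlonglongrightarrow> 1 / qpoch_inf q q"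
    by (intro tendsto_intros qpoch_tendsto_qpoch_inf qpoch_inf_nonzero qpoch_nonzero assms)
  then show ?thesis
    by (intro convergent_imp_Bseq convergentI)
qed

section \<open>The q-binomial theorem\<close>

lemma summable_q_binomial:
  fixes q b z :: complex
  assumes "norm q < 1" "norm z < 1"
  shows "summable (\<lambda>n. norm (qpoch b q n / qpoch q q n * z ^ n))"
proof -
  obtain B where B: "\<And>n. norm (qpoch b q n) \<le> B"
    using Bseq_qpoch[OF assms(1)] by (meson BseqE)
  obtain C where C: "C > 0" "\<And>n. norm (1 / qpoch q q n) \<le> C"
    using Bseq_inverse_qpoch[OF assms(1)] by (meson BseqE)
  have le: "norm (qpoch b q n / qpoch q q n * z ^ n) \<le> (B * C) * norm z ^ n" for n
  proof -
    have "norm (qpoch b q n) * norm (1 / qpoch q q n) \<le> B * C"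
      using order_trans[OF norm_ge_zero B] by (intro mult_mono B C) auto
    from mult_right_mono[OF this, of "norm z ^ n"] show ?thesis
      by (simp add: norm_mult norm_divide norm_power)
  qed
  have "summable (\<lambda>n. (B * C) * norm z ^ n)"
    using assms by (intro summable_mult summable_geometric) auto
  then show ?thesis
    by (rule summable_norm_comparison_test[rotated]) (intro exI allI impI le)
qed

text \<open>
  The recurrence \<open>c\<^sub>n\<^sub>+\<^sub>1 (1 - q^{n+1}) = c\<^sub>n (1 - b q^n)\<close> of the coefficients, summed against
  \<open>z^{n+1}\<close>, relates the values \<open>F(z)\<close> and \<open>F(qz)\<close> of the series:
  \<open>F(z) - F(qz) = z (F(z) - b F(qz))\<close>.
\<close>
lemma q_binomial_functional_equation:
  fixes q b z :: complex
  assumes "norm q < 1" "norm z < 1"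
  defines "F \<equiv> \<lambda>w. \<Sum>n. qpoch b q n / qpoch q q n * w ^ n"
  shows "(1 - z) * F z = (1 - b * z) * F (z * q)"
proof -
  define c where "c n = qpoch b q n / qpoch q q n" for n
  have "norm z * norm q \<le> norm z * 1"
    using assms by (intro mult_left_mono) auto
  then have zq: "norm (z * q) < 1"
    using assms by (simp add: norm_mult)
  have sums_F: "(\<lambda>n. c n * w ^ n) sums F w" if "norm w < 1" for w
    using summable_norm_cancel[OF summable_q_binomial[OF assms(1) that, of b]]
    unfolding F_def c_def by (rule summable_sums)
  have rec: "c (Suc n) * (1 - q ^ Suc n) = c n * (1 - b * q ^ n)" for n
    using qpoch_nonzero[OF assms(1,1), of n] qpoch_nonzero[OF assms(1,1), of "Suc n"]
    by (auto simp: c_def qpoch_Suc divide_simps)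
  have "(\<lambda>n. c n * z ^ n - c n * (z * q) ^ n) sums (F z - F (z * q))"
    by (intro sums_diff sums_F assms zq)
  then have "(\<lambda>n. c (Suc n) * z ^ Suc n - c (Suc n) * (z * q) ^ Suc n) sums (F z - F (z * q))"
    by (subst sums_Suc_iff) simp
  moreover have "c (Suc n) * z ^ Suc n - c (Suc n) * (z * q) ^ Suc n =
      z * (c n * z ^ n - b * (c n * (z * q) ^ n))" for n
  proof -
    have "c (Suc n) * z ^ Suc n - c (Suc n) * (z * q) ^ Suc n =
        (c (Suc n) * (1 - q ^ Suc n)) * z ^ Suc n"
      by (simp add: power_mult_distrib algebra_simps)
    also have "\<dots> = z * (c n * z ^ n - b * (c n * (z * q) ^ n))"
      unfolding rec by (simp add: power_mult_distrib algebra_simps)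
    finally show ?thesis .
  qed
  ultimately have "(\<lambda>n. z * (c n * z ^ n - b * (c n * (z * q) ^ n))) sums (F z - F (z * q))"
    by simp
  moreover have "(\<lambda>n. z * (c n * z ^ n - b * (c n * (z * q) ^ n))) sums
      (z * (F z - b * F (z * q)))"
    by (intro sums_mult sums_diff sums_F assms zq)
  ultimately have "F z - F (z * q) = z * (F z - b * F (z * q))"
    by (rule sums_unique2)
  then show ?thesis
    by (simp add: algebra_simps)
qed

text \<open>
  Iterating the functional equation gives \<open>(z;q)\<^sub>n F(z) = (bz;q)\<^sub>n F(z q^n)\<close>.  As \<open>n \<rightarrow> \<infinity>\<close>, the
  argument \<open>z q^n\<close> tends to \<open>0\<close>, and the power series \<open>F\<close> is continuous there with \<open>F(0) = 1\<close>.
\<close>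
theorem q_binomial_theorem:
  fixes q b z :: complex
  assumes "norm q < 1" "norm z < 1"
  shows "(\<lambda>n. qpoch b q n / qpoch q q n * z ^ n) sums (qpoch_inf (b * z) q / qpoch_inf z q)"
proof -
  define F where "F w = (\<Sum>n. qpoch b q n / qpoch q q n * w ^ n)" for w
  have small: "norm (z * q ^ n) < 1" for n
  proof -
    have "norm z * norm q ^ n \<le> norm z * 1"
      using assms by (intro mult_left_mono power_le_one) auto
    then show ?thesis
      using assms by (simp add: norm_mult norm_power)
  qed
  have iter: "qpoch z q n * F z = qpoch (b * z) q n * F (z * q ^ n)" for n
  proof (induction n)
    case (Suc n)
    have "qpoch z q (Suc n) * F z = (1 - z * q ^ n) * (qpoch z q n * F z)"
      by (simp add: qpoch_Suc)
    also have "\<dots> = qpoch (b * z) q n * ((1 - z * q ^ n) * F (z * q ^ n))"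
      by (simp add: Suc.IH)
    also have "(1 - z * q ^ n) * F (z * q ^ n) = (1 - b * (z * q ^ n)) * F (z * q ^ n * q)"
      unfolding F_def by (rule q_binomial_functional_equation[OF assms(1) small])
    finally show ?case
      by (simp add: qpoch_Suc mult_ac)
  qed simp
  have "isCont F 0"
    unfolding F_def
  proof (rule isCont_powser)
    show "summable (\<lambda>n. qpoch b q n / qpoch q q n * (1/2) ^ n)"
      by (rule summable_norm_cancel, rule summable_q_binomial) (use assms in auto)
  qed auto
  moreover have "(\<lambda>n. z * q ^ n) \<longlonglongrightarrow> 0"
    using tendsto_mult_right_zero[OF LIMSEQ_power_zero[OF assms(1)], of z] by simp
  ultimately have "(\<lambda>n. F (z * q ^ n)) \<longlonglongrightarrow> F 0"
    by (rule isCont_tendsto_compose)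
  moreover have "F 0 = 1"
    unfolding F_def powser_zero by simp
  ultimately have "(\<lambda>n. qpoch (b * z) q n * F (z * q ^ n)) \<longlonglongrightarrow> qpoch_inf (b * z) q * 1"
    by (intro tendsto_mult qpoch_tendsto_qpoch_inf assms) simp
  moreover have "(\<lambda>n. qpoch z q n * F z) \<longlonglongrightarrow> qpoch_inf z q * F z"
    by (intro tendsto_mult_right qpoch_tendsto_qpoch_inf assms)
  ultimately have "qpoch_inf z q * F z = qpoch_inf (b * z) q"
    unfolding iter by (simp add: LIMSEQ_unique)
  then have "F z = qpoch_inf (b * z) q / qpoch_inf z q"
    using qpoch_inf_nonzero[OF assms(1) qpoch_nonzero[OF assms]] by (simp add: field_simps)
  then show ?thesis
    using summable_sums[OF summable_norm_cancel[OF summable_q_binomial[OF assms, of b]]]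
    by (simp add: F_def)
qed

section \<open>Exchanging the order of summation\<close>

text \<open>
  The product \<open>u k * v m\<close> is summable over all pairs, so by domination the family \<open>f\<close> is summable
  over all pairs too.  Both orders of summation then compute the same unordered sum: rows partition
  the pairs by \<open>k\<close>, and antidiagonals partition them by \<open>n = k + m\<close>.
\<close>
lemma sums_antidiagonal_eq_iterated:
  fixes f :: "nat \<Rightarrow> nat \<Rightarrow> 'a :: banach"
  assumes "summable u" "summable v" "\<And>k m. norm (f k m) \<le> u k * v m"
    and nonneg: "\<And>k. u k \<ge> (0 :: real)" "\<And>m. v m \<ge> (0 :: real)"
    and rows: "\<And>k. f k sums g k"
  shows "summable g" "(\<lambda>n. \<Sum>k\<le>n. f k (n - k)) sums (\<Sum>k. g k)"
proof -
  have "(\<lambda>(k, m). u k * v m) summable_on (UNIV \<times> UNIV)"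
  proof (rule summable_on_SigmaI)
    show "((\<lambda>m. case (k, m) of (k, m) \<Rightarrow> u k * v m) has_sum (u k * suminf v)) UNIV" for k
      using nonneg sums_nonneg_imp_has_sum[OF summable_sums[OF assms(2)]]
      by (simp add: has_sum_cmult_right)
    have "u summable_on UNIV"
      using nonneg assms(1) by (simp add: summable_on_UNIV_nonneg_real_iff)
    then show "(\<lambda>k. u k * suminf v) summable_on UNIV"
      by (rule summable_on_cmult_left)
  qed (use nonneg in auto)
  then have "(\<lambda>p. norm (case p of (k, m) \<Rightarrow> f k m)) summable_on (UNIV \<times> UNIV)"
    by (rule Infinite_Sum.abs_summable_on_comparison_test') (use assms(3) in force)
  then have summ: "(\<lambda>(k, m). f k m) summable_on (UNIV \<times> UNIV)"
    by (rule abs_summable_summable)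
  then obtain S where S: "((\<lambda>(k, m). f k m) has_sum S) (UNIV \<times> UNIV)"
    by (auto simp: summable_on_def)
  have abs_rows: "summable (\<lambda>m. norm (f k m))" for k
    by (rule summable_norm_comparison_test[OF _ summable_mult[OF assms(2), of "u k"]])
      (use assms(3) in auto)
  have "g sums S"
    using norm_summable_imp_has_sum[OF abs_rows rows]
    by (intro has_sum_imp_sums has_sum_SigmaD[OF S]) simp
  then show "summable g"
    by (simp add: sums_iff)
  have "((\<lambda>(n, k). f k (n - k)) has_sum S) (SIGMA n:UNIV. {..n})"
    using S
    by (subst has_sum_reindex_bij_witness[where j = "\<lambda>(n, k). (k, n - k)"
          and i = "\<lambda>(k, m). (k + m, k)" and T = "UNIV \<times> UNIV"
          and h = "\<lambda>(k, m). f k m" and s' = S]) auto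
  then have "((\<lambda>n. \<Sum>k\<le>n. f k (n - k)) has_sum S) UNIV"
    by (rule has_sum_SigmaD) (auto intro: has_sum_finite)
  then show "(\<lambda>n. \<Sum>k\<le>n. f k (n - k)) sums (\<Sum>k. g k)"
    using has_sum_imp_sums sums_unique[OF \<open>g sums S\<close>] by auto
qed

lemma triangle_Suc: "Suc k * (Suc k - 1) div 2 = k + k * (k - 1) div 2" for k :: nat
proof -
  have "Suc k * (Suc k - 1) = 2 * k + k * (k - 1)"
    by (cases k) (auto simp: algebra_simps)
  then show ?thesis by simp
qed

text \<open>The ratio of consecutive terms is \<open>p ^ k * w\<close>, which tends to zero for every \<open>w\<close>; this is why
  the final series converges without any condition on \<open>y\<close>.\<close>
lemma summable_theta:
  fixes p w :: real
  assumes "0 \<le> p" "p < 1" "0 \<le> w"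
  shows "summable (\<lambda>k. p ^ (k * (k - 1) div 2) * w ^ k)"
proof -
  have "(\<lambda>k. p ^ k * w) \<longlonglongrightarrow> 0"
    using assms by (intro tendsto_mult_left_zero LIMSEQ_power_zero) auto
  then have "eventually (\<lambda>k. p ^ k * w < 1 / 2) sequentially"
    by (rule order_tendstoD) auto
  then obtain N where N: "\<And>k. k \<ge> N \<Longrightarrow> p ^ k * w < 1 / 2"
    by (auto simp: eventually_sequentially)
  show ?thesis
  proof (rule summable_ratio_test[where c = "1 / 2" and N = N])
    fix k assume "k \<ge> N"
    have "p ^ (Suc k * (Suc k - 1) div 2) * w ^ Suc k
        = (p ^ k * w) * (p ^ (k * (k - 1) div 2) * w ^ k)"
      unfolding triangle_Suc by (simp add: power_add)
    also have "\<dots> \<le> 1 / 2 * (p ^ (k * (k - 1) div 2) * w ^ k)"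
      using assms N[OF \<open>k \<ge> N\<close>] by (intro mult_right_mono) auto
    finally show "norm (p ^ (Suc k * (Suc k - 1) div 2) * w ^ Suc k)
        \<le> 1 / 2 * norm (p ^ (k * (k - 1) div 2) * w ^ k)"
      using assms by (simp add: abs_mult)
  qed simp
qed

section \<open>The generating function of the generalized Cauchy polynomials\<close>

lemma Phi_term_2_2_zero:
  "Phi_term [a, b] [d, 0] q z k =
     (-1) ^ k * q ^ (k * (k - 1) div 2) * (qpoch a q k * qpoch b q k / qpoch d q k)
     * (z ^ k / qpoch q q k)"
  by (simp add: Phi_term_def qpoch_list_def)

theorem theorem3p1:
  fixes q a x y r s :: complex
  assumes "norm q < 1"
    and "r \<noteq> 0"
    and "\<And>n. qpoch (s * x) q n \<noteq> 0"
    and "norm (r * x) < 1"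
  shows "summable (Phi_term [a, s / r] [s * x, 0] q (r * y)) \<and>
    (\<lambda>n. gen_cauchy_poly q n x y a * (qpoch (s / r) q n * r ^ n / qpoch q q n)) sums
      (qpoch_inf (s * x) q / qpoch_inf (r * x) q * Phi [a, s / r] [s * x, 0] q (r * y))"
proof -
  define b where "b = s / r"
  define K where "K = qpoch_inf (s * x) q / qpoch_inf (r * x) q"
  define A where "A k = (-1) ^ k * q ^ (k * (k - 1) div 2) * qpoch a q k * (r * y) ^ k / qpoch q q k"
    for k
  define f where "f k m = A k * (qpoch b q (k + m) * (r * x) ^ m / qpoch q q m)" for k m
  define T where "T = Phi_term [a, b] [s * x, 0] q (r * y)"
  have "K \<noteq> 0"
    using assms qpoch_nonzero[OF assms(1,4)] by (simp add: K_def qpoch_inf_nonzero)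

  \<comment> \<open>The \<open>q\<close>-binomial theorem applies with first parameter \<open>b q^k\<close>; multiplied by the argument
    \<open>rx\<close>, this becomes \<open>s x q^k\<close>, from which \<open>(sx;q)\<^sub>k\<close> is split off.\<close>
  have row: "f k sums (K * T k)" for k
  proof -
    have "(\<lambda>m. qpoch (b * q ^ k) q m / qpoch q q m * (r * x) ^ m) sums
        (qpoch_inf (b * q ^ k * (r * x)) q / qpoch_inf (r * x) q)"
      by (rule q_binomial_theorem) (use assms in auto)
    also have "b * q ^ k * (r * x) = s * x * q ^ k"
      using assms(2) by (simp add: b_def)
    also have "qpoch_inf (s * x * q ^ k) q = qpoch_inf (s * x) q / qpoch (s * x) q k"
      using qpoch_inf_shift[OF assms(1), of "s * x" k] assms(3)[of k] by (simp add: field_simps)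
    finally have "(\<lambda>m. qpoch (b * q ^ k) q m / qpoch q q m * (r * x) ^ m) sums
        (K / qpoch (s * x) q k)"
      by (simp add: K_def mult.commute)
    from sums_mult[OF this, of "A k * qpoch b q k"] show ?thesis
      by (simp add: f_def [abs_def] qpoch_add T_def Phi_term_2_2_zero A_def mult_ac)
  qed

  obtain Ma where Ma: "\<And>n. norm (qpoch a q n) \<le> Ma"
    using Bseq_qpoch[OF assms(1)] by (meson BseqE)
  obtain Mb where Mb: "\<And>n. norm (qpoch b q n) \<le> Mb"
    using Bseq_qpoch[OF assms(1)] by (meson BseqE)
  obtain C where C: "C > 0" "\<And>n. norm (1 / qpoch q q n) \<le> C"
    using Bseq_inverse_qpoch[OF assms(1)] by (meson BseqE)
  have pos: "Ma \<ge> 0" "Mb \<ge> 0"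
    using order_trans[OF norm_ge_zero Ma] order_trans[OF norm_ge_zero Mb] by auto
  define u where "u k = Ma * C * (norm q ^ (k * (k - 1) div 2) * norm (r * y) ^ k)" for k
  define v where "v m = Mb * C * norm (r * x) ^ m" for m
  have bound: "norm (f k m) \<le> u k * v m" for k m
  proof -
    have "norm (A k) = norm (qpoch a q k) * norm (1 / qpoch q q k)
        * (norm q ^ (k * (k - 1) div 2) * norm (r * y) ^ k)"
      by (simp add: A_def norm_mult norm_divide norm_power)
    also have "\<dots> \<le> u k"
      unfolding u_def using pos C(1) by (intro mult_right_mono mult_mono Ma C(2)) auto
    finally have A: "norm (A k) \<le> u k" .
    have "norm (qpoch b q (k + m) * (r * x) ^ m / qpoch q q m)
        = norm (qpoch b q (k + m)) * norm (1 / qpoch q q m) * norm (r * x) ^ m"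
      by (simp add: norm_mult norm_divide norm_power)
    also have "\<dots> \<le> v m"
      unfolding v_def using pos C(1) by (intro mult_right_mono mult_mono Mb C(2)) auto
    finally show ?thesis
      unfolding f_def norm_mult[of "A k"] using order_trans[OF norm_ge_zero A]
      by (intro mult_mono A) auto
  qed
  have "summable u"
    unfolding u_def [abs_def] using assms(1) by (intro summable_mult summable_theta) auto
  moreover have "summable v"
    unfolding v_def [abs_def] using assms(4) by (intro summable_mult summable_geometric) auto
  moreover have "u k \<ge> 0" "v m \<ge> 0" for k m
    using pos C(1) by (auto simp: u_def v_def)
  ultimately have iterated: "summable (\<lambda>k. K * T k)"
      "(\<lambda>n. \<Sum>k\<le>n. f k (n - k)) sums (\<Sum>k. K * T k)"
    using sums_antidiagonal_eq_iterated[of u v f "\<lambda>k. K * T k", OF _ _ bound _ _ row] by simp_all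
  \<comment> \<open>The interchange gives convergence of the multiple by \<open>K\<close> only, and \<open>K\<close> can be cancelled because
    \<open>(sx;q)\<^sub>\<infinity>\<close> does not vanish.\<close>
  have T: "summable T"
    using iterated(1) \<open>K \<noteq> 0\<close> by (simp add: summable_cmult_iff)

  have "(\<Sum>k\<le>n. f k (n - k))
      = gen_cauchy_poly q n x y a * (qpoch (s / r) q n * r ^ n / qpoch q q n)" for n
    unfolding gen_cauchy_poly_def sum_distrib_right
  proof (rule sum.cong)
    fix k assume "k \<in> {..n}"
    then have "r ^ n = r ^ k * r ^ (n - k)"
      by (simp flip: power_add)
    then show "f k (n - k) = qbinom q n k * (- 1) ^ k * q ^ (k * (k - 1) div 2) * qpoch a q k
        * x ^ (n - k) * y ^ k * (qpoch (s / r) q n * r ^ n / qpoch q q n)"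
      using \<open>k \<in> {..n}\<close> qpoch_nonzero[OF assms(1,1)]
      by (simp add: f_def A_def b_def qbinom_def power_mult_distrib)
  qed simp
  then show ?thesis
    using iterated(2) T suminf_mult[OF T, of K]
    by (simp add: T_def b_def K_def Phi_def)
qed

end
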